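(* Let $A$ be a set of integers. Then \[C(A)\geq\left\lfloor\frac{R_2(A)^{1/2}}{4}\right\rfloor.\] Consequently, if $\{1,\ldots,N\}=A_1\cup\cdots\cup A_r$ is a partition of $\{1,\ldots,N\}$ (with $r,N$ positive integers) and $N\geq 3^{r^2+r}$, then \[\max\{C(A_i):1\leq i\leq r\}\geq \left\lfloor\frac{N^{1/(2r)}}{4\cdot 3^{r/2}}\right\rfloor.\] Similarly, if $\delta\in(0,1]$, $s=\lceil \log_2(1/(4\delta))\rceil$, $N\geq\max\{(2s)^s,3^{73s}\}$ is a positive integer and $A\subseteq\{1,\ldots,N\}$ satisfies $|A|\geq\delta N$, then \[C(A-A)\geq \left\lfloor\frac{N^{1/(16s+16)}}{4\cdot3^8}\right\rfloor.\]
   Context: $A-A=\{a-a':a,a'\in A\}$. A finite increasing sequence $a_1<\cdots<a_n$ is strictly convex if the sequence of first differences $a_{i+1}-a_i$ is strictly monotone; $C(B)$ denotes the length of the longest strictly convex sequence contained in $B$. For $L\geq 1$, a finite increasing sequence of real numbers $a_1<\cdots<a_n$ is called $L$-regular if there is a positive real number $X$ such that $X\leq a_{i+1}-a_i\leq LX$ for all $i=1,\ldots,n-1$. For a set $B$ of real numbers, $R_L(B)=\max\{|B'|:B'\subseteq B,\ B'\text{ is }L\text{-regular}\}$.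
   Formalization: In the last part s is read as max(0, ⌈log_2(1/(4δ))⌉), because for 1/2 ≤ δ < 1 the stated s equals −1 and the exponent 1/(16s+16) is undefined; for δ = 1 this gives a stronger bound than the literal one. *)

theory Defs
  imports Complex_Main "HOL-Library.Extended_Nat" "HOL-Library.Disjoint_Sets"
begin

definition difference_set :: "'a::minus set \<Rightarrow> 'a set" where
  "difference_set A = {a - a' | a a'. a \<in> A \<and> a' \<in> A}"

definition first_differences :: "'a::minus list \<Rightarrow> 'a list" where
  "first_differences xs = map (\<lambda>i. xs ! Suc i - xs ! i) [0..<length xs - 1]"

text \<open>
  ``Strictly monotone'' differences may be increasing or decreasing, so that both convex and
  concave sequences qualify; sequences of length at most 2 qualify vacuously.
\<close>

definition strictly_convex :: "'a::linordered_idom list \<Rightarrow> bool" where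
  "strictly_convex xs \<longleftrightarrow> sorted_wrt (<) xs \<and>
     (sorted_wrt (<) (first_differences xs) \<or> sorted_wrt (>) (first_differences xs))"

text \<open>
  The extremal quantities are suprema in \<^typ>\<open>enat\<close>, so that they are meaningful for infinite
  sets too; for a finite set they are finite and attained.
\<close>

definition convex_number :: "'a::linordered_idom set \<Rightarrow> enat" where
  "convex_number B = (SUP xs \<in> {xs. strictly_convex xs \<and> set xs \<subseteq> B}. enat (length xs))"

definition regular_seq :: "real \<Rightarrow> real list \<Rightarrow> bool" where
  "regular_seq L xs \<longleftrightarrow> sorted_wrt (<) xs \<and>
     (\<exists>X>0. \<forall>d \<in> set (first_differences xs). X \<le> d \<and> d \<le> L * X)"

definition regular_set :: "real \<Rightarrow> real set \<Rightarrow> bool" where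
  "regular_set L B \<longleftrightarrow> finite B \<and> regular_seq L (sorted_list_of_set B)"

definition regular_number :: "real \<Rightarrow> real set \<Rightarrow> enat" where
  "regular_number L B = (SUP B' \<in> {B'. B' \<subseteq> B \<and> regular_set L B'}. enat (card B'))"

end

theory Submission
  imports Defs
begin

text \<open>All three bounds rest on one criterion, \<open>convex_number_ge_of_windows\<close>: a
  set meeting each of the windows from \<open>a + K * j\<^sup>2\<close> to
  \<open>a + K * (j\<^sup>2 + 1)\<close>, for \<open>j < m\<close>, contains a strictly convex
  sequence of length \<open>m\<close>. A 2-regular set has no long gaps, so it meets every window of
  length \<open>2 * X\<close> in its range, and about \<open>2 * m\<^sup>2\<close> elements make
  room for \<open>m\<close> windows. For partitions and difference sets the criterion is used in
  contrapositive form: if the convex number is below \<open>m\<close>, some window is missed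
  entirely. In a partition the remaining classes cover that window, and induction on the number of
  classes applies (\<open>convex_number_ge_of_cover\<close>). A window missed by
  \<open>A - A\<close> forbids many pairs in \<open>A\<close>, which forces larger density on a
  shorter interval; iterating this increment by a factor 3/2 would push the density above 1
  (\<open>convex_number_difference_set_ge\<close>).\<close>

section \<open>First differences, and passage from integers to reals\<close>

lemma nth_first_differences:
  "Suc i < length xs \<Longrightarrow> first_differences xs ! i = xs ! Suc i - xs ! i"
  by (simp add: first_differences_def less_diff_conv)

lemma length_first_differences [simp]: "length (first_differences xs) = length xs - 1"
  by (simp add: first_differences_def less_diff_conv)

lemma first_differences_map_of_int:
  "first_differences (map of_int xs) = map of_int (first_differences xs)"
  by (auto simp: first_differences_def)

lemma strictly_convex_map_of_int:
  "strictly_convex (map (of_int :: int \<Rightarrow> 'a::linordered_idom) xs) \<longleftrightarrow> strictly_convex xs"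
  by (simp add: strictly_convex_def first_differences_map_of_int sorted_wrt_map)

lemma convex_number_ge:
  "strictly_convex xs \<Longrightarrow> set xs \<subseteq> B \<Longrightarrow> enat (length xs) \<le> convex_number B"
  unfolding convex_number_def by (rule SUP_upper) simp

lemma convex_number_mono: "A \<subseteq> B \<Longrightarrow> convex_number A \<le> convex_number B"
  unfolding convex_number_def by (rule SUP_subset_mono) auto

text \<open>Regularity is a notion for real sets, while the theorem asks for convex sequences of
  integers; this brings the latter back.\<close>

lemma convex_number_of_int_image_le:
  "convex_number ((of_int :: int \<Rightarrow> 'a::linordered_idom) ` A) \<le> convex_number A"
proof -
  have "enat (length xs) \<le> convex_number A"
    if xs: "strictly_convex xs" "set xs \<subseteq> of_int ` A" for xs :: "'a list"
  proof -
    have "xs \<in> lists (of_int ` A)"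
      using xs(2) by auto
    then obtain ys where "xs = map of_int ys" "set ys \<subseteq> A"
      unfolding lists_image by auto
    then show ?thesis
      using convex_number_ge[of ys A] xs(1) by (simp add: strictly_convex_map_of_int)
  qed
  then show ?thesis
    unfolding convex_number_def[of "of_int ` A"] by (intro SUP_least) auto
qed

section \<open>Convex sequences from quadratically spaced windows\<close>

text \<open>
  The second differences of \<open>a + K * j\<^sup>2\<close> equal \<open>2 * K\<close>, which exceeds the error made by moving
  each term within its window.
\<close>

lemma convex_number_ge_of_windows:
  fixes S :: "'a::linordered_idom set"
  assumes windows: "\<And>j. j < m \<Longrightarrow> S \<inter> {a + K * of_nat (j\<^sup>2) <.. a + K * of_nat (j\<^sup>2 + 1)} \<noteq> {}"
  shows "enat m \<le> convex_number S"
proof -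
  have "\<forall>j. \<exists>x. j < m \<longrightarrow> x \<in> S \<and> a + K * of_nat (j\<^sup>2) < x \<and> x \<le> a + K * of_nat (j\<^sup>2 + 1)"
    using windows by fastforce
  then obtain c where c: "\<And>j. j < m \<Longrightarrow> c j \<in> S"
    "\<And>j. j < m \<Longrightarrow> a + K * of_nat (j\<^sup>2) < c j" "\<And>j. j < m \<Longrightarrow> c j \<le> a + K * of_nat (j\<^sup>2 + 1)"
    by metis
  define xs where "xs = map c [0..<m]"
  \<comment> \<open>No sign of \<open>K\<close> is assumed: the window at \<open>j = 0\<close> is
    inhabited, which forces \<open>K\<close> to be positive.\<close>
  have K: "0 < K" if "0 < m"
    using c(2,3)[OF that] by simp
  have step: "c j < c (Suc j)" if "Suc j < m" for j
  proof -
    have "K * of_nat (j\<^sup>2 + 1) \<le> K * of_nat ((Suc j)\<^sup>2)"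
      using K that by (intro mult_left_mono) (auto simp: power2_eq_square)
    then show ?thesis
      using c(3)[of j] c(2)[of "Suc j"] that by simp
  qed
  \<comment> \<open>The lower bounds for \<open>c j\<close> and \<open>c (j + 2)\<close> and twice
    the upper bound for \<open>c (j + 1)\<close> both sum to
    \<open>2 * a + K * (2 * j\<^sup>2 + 4 * j + 4)\<close>; strictness comes from the windows being
    open on the left.\<close>
  have convex: "c (Suc j) - c j < c (Suc (Suc j)) - c (Suc j)" if "Suc (Suc j) < m" for j
    using c(2)[of j] c(3)[of "Suc j"] c(2)[of "Suc (Suc j)"] that
    by (simp add: power2_eq_square algebra_simps)
  have "strictly_convex xs"
    unfolding strictly_convex_def using step convex
    by (auto simp: xs_def sorted_wrt_iff_nth_Suc_transp nth_first_differences)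
  moreover have "set xs \<subseteq> S"
    using c(1) by (auto simp: xs_def)
  ultimately show ?thesis
    using convex_number_ge[of xs S] by (simp add: xs_def)
qed

section \<open>Regular sets\<close>

text \<open>Lower bounds on the gaps make the sequence long; upper bounds put the first term beyond
  \<open>t\<close> within \<open>L * X\<close> of \<open>t\<close>.\<close>

lemma regular_set_window:
  assumes "regular_seq L xs" "xs \<noteq> []"
  obtains X where "0 < X" "real (length xs - 1) * X \<le> last xs - hd xs"
    "\<And>t. hd xs - L * X \<le> t \<Longrightarrow> t < last xs \<Longrightarrow> set xs \<inter> {t <.. t + L * X} \<noteq> {}"
proof -
  obtain X where X: "0 < X"
    and d: "\<And>d. d \<in> set (first_differences xs) \<Longrightarrow> X \<le> d \<and> d \<le> L * X"
    using assms(1) by (auto simp: regular_seq_def)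
  have gap: "X \<le> xs ! Suc i - xs ! i \<and> xs ! Suc i - xs ! i \<le> L * X" if "Suc i < length xs" for i
    using d[OF nth_mem, of i] that by (simp add: nth_first_differences less_diff_conv)
  have "real i * X \<le> xs ! i - hd xs" if "i < length xs" for i
    using that
  proof (induction i)
    case 0
    then show ?case by (simp add: hd_conv_nth)
  next
    case (Suc i)
    then show ?case using gap[of i] by (simp add: algebra_simps)
  qed
  from this[of "length xs - 1"]
  have len: "real (length xs - 1) * X \<le> last xs - hd xs"
    using assms(2) by (simp add: last_conv_nth)
  have "set xs \<inter> {t <.. t + L * X} \<noteq> {}" if t: "hd xs - L * X \<le> t" "t < last xs" for t
  proof -
    define i where "i = (LEAST i. i < length xs \<and> t < xs ! i)"
    have "length xs - 1 < length xs \<and> t < xs ! (length xs - 1)"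
      using t(2) assms(2) by (simp add: last_conv_nth)
    then have i: "i < length xs \<and> t < xs ! i"
      unfolding i_def by (rule LeastI)
    have "xs ! i \<le> t + L * X"
    \<comment> \<open>The first term has no predecessor, so there the lower bound on
      \<open>t\<close> takes the place of the gap bound.\<close>
    proof (cases i)
      case 0
      then show ?thesis using t(1) assms(2) by (simp add: hd_conv_nth)
    next
      case (Suc k)
      then have "\<not> t < xs ! k"
        using i not_less_Least[of k "\<lambda>i. i < length xs \<and> t < xs ! i"] by (auto simp: i_def)
      then show ?thesis using gap[of k] i Suc by simp
    qed
    then have "xs ! i \<in> set xs \<inter> {t <.. t + L * X}" using i by simp
    then show ?thesis by blast
  qed
  then show ?thesis using that X len by blast
qed

lemma convex_number_ge_of_regular_set:
  assumes "regular_set L B" "1 \<le> L" "L * real (m\<^sup>2) \<le> real (card B)"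
  shows "enat m \<le> convex_number B"
proof (cases "m = 0")
  case True
  then show ?thesis by (simp flip: zero_enat_def)
next
  case False
  define xs where "xs = sorted_list_of_set B"
  have xs: "set xs = B" "length xs = card B" "regular_seq L xs"
    using assms(1) by (simp_all add: xs_def regular_set_def)
  have "0 < L * real (m\<^sup>2)"
    using False assms(2) by simp
  then have card: "0 < card B"
    using assms(3) by linarith
  then have "xs \<noteq> []" using xs(2) by auto
  then obtain X where X: "0 < X" "real (length xs - 1) * X \<le> last xs - hd xs"
    and window: "\<And>t. hd xs - L * X \<le> t \<Longrightarrow> t < last xs \<Longrightarrow> set xs \<inter> {t <.. t + L * X} \<noteq> {}"
    using regular_set_window[OF xs(3)] by metis
  show ?thesis
  proof (rule convex_number_ge_of_windows)
    fix j assume "j < m"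
    then have "(j + 1)\<^sup>2 \<le> m\<^sup>2"
      by (intro power_mono) auto
    then have "j\<^sup>2 + 1 \<le> m\<^sup>2"
      by (simp add: power2_eq_square)
    then have "L * real (j\<^sup>2 + 1) \<le> L * real (m\<^sup>2)"
      using assms(2) by (intro mult_left_mono) linarith+
    \<comment> \<open>The windows start one window length before \<open>hd xs\<close>; with
      \<open>1 \<le> L\<close> this slack makes up for there being one gap fewer than terms.\<close>
    then have "L * real (j\<^sup>2) - L < real (length xs - 1)"
      using assms(2,3) xs(2) card by (simp add: algebra_simps of_nat_diff)
    then have "(L * real (j\<^sup>2) - L) * X < real (length xs - 1) * X"
      using X(1) by simp
    then have "hd xs - L * X + L * X * real (j\<^sup>2) < last xs"
      using X(2) by (simp add: algebra_simps)
    moreover have "hd xs - L * X \<le> hd xs - L * X + L * X * real (j\<^sup>2)"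
      using X(1) assms(2) by simp
    ultimately have "set xs \<inter> {hd xs - L * X + L * X * real (j\<^sup>2) <..
        hd xs - L * X + L * X * real (j\<^sup>2) + L * X} \<noteq> {}"
      by (intro window)
    then show "B \<inter> {hd xs - L * X + L * X * real (j\<^sup>2) <..
        hd xs - L * X + L * X * real (j\<^sup>2 + 1)} \<noteq> {}"
      by (simp add: xs(1) algebra_simps)
  qed
qed

section \<open>Covers of an interval by few sets\<close>

text \<open>
  A colour class whose convex number is below \<open>m\<close> misses one of the \<open>m\<close> windows, so the
  other colours cover an interval that is only \<open>m\<^sup>2\<close> times shorter.
\<close>

lemma convex_number_ge_of_cover:
  fixes A :: "'i \<Rightarrow> int set"
  assumes "finite I" "1 \<le> m" "{a <.. a + int ((m\<^sup>2) ^ card I)} \<subseteq> (\<Union>i\<in>I. A i)"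
  shows "\<exists>i\<in>I. enat m \<le> convex_number (A i)"
  using assms
proof (induction I arbitrary: a rule: finite_induct)
  case empty
  then show ?case by simp
next
  case (insert i I)
  \<comment> \<open>The window length is exactly what the induction hypothesis asks of the remaining
    sets.\<close>
  define K where "K = (m\<^sup>2) ^ card I"
  show ?case
  proof (cases "enat m \<le> convex_number (A i)")
    case True
    then show ?thesis by blast
  next
    case False
    then obtain j where j: "j < m"
      "A i \<inter> {a + int K * int (j\<^sup>2) <.. a + int K * int (j\<^sup>2 + 1)} = {}"
      using convex_number_ge_of_windows[of m "A i" a "int K"] by auto
    define b where "b = a + int K * int (j\<^sup>2)"
    have "(j + 1)\<^sup>2 \<le> m\<^sup>2"
      using j(1) by (intro power_mono) auto
    then have "j\<^sup>2 + 1 \<le> m\<^sup>2"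
      by (simp add: power2_eq_square)
    then have "K * (j\<^sup>2 + 1) \<le> K * m\<^sup>2"
      by (rule mult_le_mono2)
    then have "int (K * (j\<^sup>2 + 1)) \<le> int (K * m\<^sup>2)"
      by (simp only: zle_int)
    then have "b + int K \<le> a + int ((m\<^sup>2) ^ card (insert i I))"
      using insert.hyps by (simp add: b_def K_def algebra_simps)
    moreover have "a \<le> b" by (simp add: b_def)
    ultimately have "{b <.. b + int K} \<subseteq> {a <.. a + int ((m\<^sup>2) ^ card (insert i I))}"
      by auto
    moreover have "A i \<inter> {b <.. b + int K} = {}"
      using j(2) by (simp add: b_def algebra_simps)
    ultimately have "{b <.. b + int K} \<subseteq> (\<Union>i\<in>I. A i)"
      using insert.prems(2) by blast
    then show ?thesis
      using insert.IH[of b] insert.prems(1) by (auto simp: K_def)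
  qed
qed

section \<open>Density increment for difference sets\<close>

text \<open>Double counting over the translates \<open>x\<close>: each element of \<open>A\<close>
  lies in \<open>h\<close> of the intervals and in \<open>h\<close> of their shifts, while each
  \<open>x\<close> contributes at most \<open>\<mu>\<close> because one of its two intervals is
  empty.\<close>

lemma card_le_of_empty_or_shift_empty:
  fixes A :: "int set" and h v M :: nat
  assumes A: "A \<subseteq> {a <.. a + int M}"
    and empty: "\<And>x. A \<inter> {x <.. x + int h} = {} \<or> A \<inter> {x + int v <.. x + int v + int h} = {}"
    and bound: "\<And>x. real (card (A \<inter> {x <.. x + int h})) \<le> \<mu>"
  shows "2 * real h * real (card A) \<le> \<mu> * real (M + h + v)"
proof -
  \<comment> \<open>\<open>W\<close> contains every \<open>x\<close> whose interval or shifted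
    interval can meet \<open>A\<close>.\<close>
  define W where "W = {a - int h - int v ..< a + int M}"
  have fin: "finite W" "finite A"
    using A finite_subset by (auto simp: W_def)
  have "{x \<in> W. x < y \<and> y \<le> x + int h} = {y - int h ..< y}" if "y \<in> A" for y
    using A that by (auto simp: W_def)
  then have 1: "(\<Sum>x\<in>W. card {y \<in> A. x < y \<and> y \<le> x + int h}) = h * card A"
    using fin by (intro sum_multicount) auto
  have "{x \<in> W. x + int v < y \<and> y \<le> x + int v + int h} = {y - int v - int h ..< y - int v}"
    if "y \<in> A" for y
    using A that by (auto simp: W_def)
  then have 2: "(\<Sum>x\<in>W. card {y \<in> A. x + int v < y \<and> y \<le> x + int v + int h}) = h * card A"
    using fin by (intro sum_multicount) auto
  have [simp]: "A \<inter> {x <.. x + int h} = {y \<in> A. x < y \<and> y \<le> x + int h}" for x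
    by auto
  have "2 * real h * real (card A) = real ((\<Sum>x\<in>W. card {y \<in> A. x < y \<and> y \<le> x + int h}) +
      (\<Sum>x\<in>W. card {y \<in> A. x + int v < y \<and> y \<le> x + int v + int h}))"
    unfolding 1 2 by simp
  also have "\<dots> = (\<Sum>x\<in>W. real (card (A \<inter> {x <.. x + int h})) +
      real (card (A \<inter> {x + int v <.. x + int v + int h})))"
    by (simp add: sum.distrib)
  also have "\<dots> \<le> (\<Sum>x\<in>W. \<mu>)"
  proof (rule sum_mono)
    fix x
    show "real (card (A \<inter> {x <.. x + int h})) +
      real (card (A \<inter> {x + int v <.. x + int v + int h})) \<le> \<mu>"
      using empty[of x] bound[of x] bound[of "x + int v"] by (metis add_0 add.right_neutral card.empty of_nat_0)
  qed
  also have "\<dots> = \<mu> * real (M + h + v)"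
    by (simp add: W_def)
  finally show ?thesis .
qed

text \<open>
  If \<open>A - A\<close> misses an interval \<open>{u <.. u + 2 * h}\<close>, then \<open>A\<close> cannot meet both an interval of
  length \<open>h\<close> and its shift by \<open>u + h\<close>, so \<open>A\<close> is nearly twice as dense on some interval of length
  \<open>h\<close>. A density above 1 is eventually reached.
\<close>

lemma convex_number_difference_set_ge:
  fixes A :: "int set"
  assumes "1 \<le> m" "(6 * m\<^sup>2) ^ t \<le> M" "2 ^ t * real M < 3 ^ t * real (card (A \<inter> {a <.. a + int M}))"
  shows "enat m \<le> convex_number (difference_set A)"
  using assms
proof (induction t arbitrary: a M)
  case 0
  have "card (A \<inter> {a <.. a + int M}) \<le> card {a <.. a + int M}"
    by (intro card_mono) auto
  then show ?case
    using 0 by simp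
next
  case (Suc t)
  define h where "h = (6 * m\<^sup>2) ^ t"
  define B where "B = A \<inter> {a <.. a + int M}"
  show ?case
  proof (rule ccontr)
    assume contr: "\<not> enat m \<le> convex_number (difference_set A)"
    then obtain j where j: "j < m" "difference_set A \<inter>
        {0 + int (2 * h) * int (j\<^sup>2) <.. 0 + int (2 * h) * int (j\<^sup>2 + 1)} = {}"
      using convex_number_ge_of_windows[of m "difference_set A" 0 "int (2 * h)"] by metis
    define u where "u = 2 * h * j\<^sup>2"
    have gap: "difference_set A \<inter> {int u <.. int u + int (2 * h)} = {}"
      using j(2) by (simp add: u_def algebra_simps)
    \<comment> \<open>By the induction hypothesis, density above \<open>(2/3) ^ t\<close> on any
      interval of length \<open>h\<close> would already give the claim.\<close>
    have dense: "3 ^ t * real (card (A \<inter> {x <.. x + int h})) \<le> 2 ^ t * real h" for x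
      using Suc.IH[of h x] Suc.prems(1) contr by (force simp: h_def)
    have "2 * real h * real (card B) \<le> (2 ^ t * real h / 3 ^ t) * real (M + h + (u + h))"
    proof (rule card_le_of_empty_or_shift_empty)
      show "B \<subseteq> {a <.. a + int M}" by (simp add: B_def)
      show "B \<inter> {x <.. x + int h} = {} \<or> B \<inter> {x + int (u + h) <.. x + int (u + h) + int h} = {}" for x
      proof (rule ccontr)
        assume "\<not> ?thesis"
        then obtain y z where yz: "y \<in> A" "z \<in> A" "x < y" "y \<le> x + int h"
          "x + int (u + h) < z" "z \<le> x + int (u + h) + int h"
          by (auto simp: B_def)
        then have "z - y \<in> difference_set A" "z - y \<in> {int u <.. int u + int (2 * h)}"
          by (auto simp: difference_set_def)
        then show False using gap by blast
      qed
      show "real (card (B \<inter> {x <.. x + int h})) \<le> 2 ^ t * real h / 3 ^ t" for x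
      proof -
        have "card (B \<inter> {x <.. x + int h}) \<le> card (A \<inter> {x <.. x + int h})"
          by (intro card_mono) (auto simp: B_def)
        then have "3 ^ t * real (card (B \<inter> {x <.. x + int h})) \<le> 3 ^ t * real (card (A \<inter> {x <.. x + int h}))"
          by simp
        also note dense
        finally show ?thesis by (simp add: field_simps)
      qed
    qed
    moreover have "0 < h"
      using Suc.prems(1) by (simp add: h_def)
    ultimately have "real h * (2 * (3 ^ t * real (card B))) \<le> real h * (2 ^ t * real (M + h + (u + h)))"
      by (simp add: field_simps)
    then have 1: "2 * (3 ^ t * real (card B)) \<le> 2 ^ t * real (M + h + (u + h))"
      using \<open>0 < h\<close> by simp
    \<comment> \<open>The boundary loss \<open>h + (u + h)\<close> equals
      \<open>2 * h * (j\<^sup>2 + 1)\<close>, at most \<open>M / 3\<close> thanks to the factor 6.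
      So the density of \<open>B\<close> is at most
      \<open>(2/3) ^ t * (4/3) / 2 = (2/3) ^ (t + 1)\<close>.\<close>
    have "(j + 1)\<^sup>2 \<le> m\<^sup>2"
      using j(1) by (intro power_mono) auto
    then have "j\<^sup>2 + 1 \<le> m\<^sup>2"
      by (simp add: power2_eq_square)
    then have "h * (j\<^sup>2 + 1) \<le> h * m\<^sup>2"
      by (rule mult_le_mono2)
    moreover have "6 * (h * m\<^sup>2) \<le> M"
      using Suc.prems(2) by (simp add: h_def ac_simps)
    ultimately have "3 * (M + h + (u + h)) \<le> 4 * M"
      by (simp add: u_def algebra_simps)
    then have "3 * real (M + h + (u + h)) \<le> 4 * real M"
      by linarith
    then have "2 ^ t * (3 * real (M + h + (u + h))) \<le> 2 ^ t * (4 * real M)"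
      by (intro mult_left_mono) auto
    then have "3 * (2 ^ t * real (M + h + (u + h))) \<le> 4 * (2 ^ t * real M)"
      by (simp only: mult.left_commute)
    then have "3 ^ Suc t * real (card B) \<le> 2 ^ Suc t * real M"
      using 1 unfolding power_Suc mult.assoc by linarith
    then show False
      using Suc.prems(3) by (simp add: B_def)
  qed
qed

section \<open>The explicit bounds\<close>

text \<open>Trades the rounded roots in the theorem for the polynomial inequalities used by the
  combinatorial lemmas.\<close>

lemma power_le_of_le_floor_powr:
  assumes "m = nat \<lfloor>x powr (1 / real k) / c\<rfloor>" "0 < c" "0 < x" "0 < k"
  shows "(c * real m) ^ k \<le> x"
proof -
  have "real m \<le> x powr (1 / real k) / c"
    using assms by simp
  then have "c * real m \<le> x powr (1 / real k)"
    using assms(2) by (simp add: field_simps)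
  then have "(c * real m) ^ k \<le> (x powr (1 / real k)) ^ k"
    using assms(2) by (intro power_mono) auto
  also have "\<dots> = x"
    using assms(3,4) by (simp add: powr_powr flip: powr_realpow)
  finally show ?thesis .
qed

lemma convex_number_ge_regular_number:
  "case regular_number 2 (real_of_int ` A) of
     enat R \<Rightarrow> convex_number A \<ge> enat (nat \<lfloor>sqrt (real R) / 4\<rfloor>)
   | \<infinity> \<Rightarrow> convex_number A = \<infinity>"
proof -
  let ?\<B> = "{B. B \<subseteq> real_of_int ` A \<and> regular_set 2 B}"
  have key: "enat m \<le> convex_number A" if "B \<in> ?\<B>" "2 * m\<^sup>2 \<le> card B" for m B
  proof -
    have "2 * real (m\<^sup>2) \<le> real (card B)"
      using that(2) by linarith
    then have "enat m \<le> convex_number B"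
      using that(1) by (intro convex_number_ge_of_regular_set[of 2]) auto
    also have "\<dots> \<le> convex_number (real_of_int ` A)"
      using that(1) by (intro convex_number_mono) auto
    also have "\<dots> \<le> convex_number A"
      by (rule convex_number_of_int_image_le)
    finally show ?thesis .
  qed
  show ?thesis
  proof (cases "regular_number 2 (real_of_int ` A)")
    case (enat R)
    define m where "m = nat \<lfloor>sqrt (real R) / 4\<rfloor>"
    have "enat m \<le> convex_number A"
    proof (cases "m = 0")
      case True
      then show ?thesis by (simp flip: zero_enat_def)
    next
      case False
      have "real m \<le> sqrt (real R) / 4"
        unfolding m_def by (metis of_nat_floor real_sqrt_ge_0_iff of_nat_0_le_iff zero_le_divide_iff zero_le_numeral)
      then have "(4 * real m)\<^sup>2 \<le> (sqrt (real R))\<^sup>2"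
        by (intro power_mono) auto
      then have "real (16 * m\<^sup>2) \<le> real R"
        by (simp add: power_mult_distrib)
      then have "16 * m\<^sup>2 \<le> R"
        by (simp only: of_nat_le_iff)
      moreover have "0 < m\<^sup>2"
        using False by simp
      \<comment> \<open>Strictness lets a witness be drawn from the supremum without showing that it
        is attained.\<close>
      ultimately have "2 * m\<^sup>2 < R"
        by linarith
      then have "enat (2 * m\<^sup>2) < regular_number 2 (real_of_int ` A)"
        by (simp add: enat)
      then obtain B where "B \<in> ?\<B>" "enat (2 * m\<^sup>2) < enat (card B)"
        unfolding regular_number_def less_SUP_iff by blast
      then show ?thesis by (intro key) auto
    qed
    then show ?thesis by (simp add: enat m_def)
  next
    case infinity
    have "enat m \<le> convex_number A" for m
    proof -
      have "enat (2 * m\<^sup>2) < regular_number 2 (real_of_int ` A)"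
        by (simp add: infinity)
      then obtain B where "B \<in> ?\<B>" "enat (2 * m\<^sup>2) < enat (card B)"
        unfolding regular_number_def less_SUP_iff by blast
      then show ?thesis by (intro key) auto
    qed
    then have "convex_number A = \<infinity>"
      by (metis Suc_ile_eq enat.exhaust less_irrefl)
    then show ?thesis by (simp add: infinity)
  qed
qed

lemma convex_number_partition:
  fixes A :: "nat \<Rightarrow> int set"
  assumes "r \<ge> 1" "N \<ge> 1" "(\<Union>i\<in>{1..r}. A i) = {1..int N}"
  shows "(MAX i\<in>{1..r}. convex_number (A i)) \<ge>
    enat (nat \<lfloor>real N powr (1 / (2 * real r)) / (4 * 3 powr (real r / 2))\<rfloor>)"
proof -
  define c :: real where "c = 4 * 3 powr (real r / 2)"
  define m where "m = nat \<lfloor>real N powr (1 / real (2 * r)) / c\<rfloor>"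
  have c: "1 \<le> c"
    using ge_one_powr_ge_zero[of 3 "real r / 2"] by (simp add: c_def)
  have "\<exists>i\<in>{1..r}. enat m \<le> convex_number (A i)"
  proof (cases "m = 0")
    case True
    then show ?thesis using assms(1) by (auto simp flip: zero_enat_def)
  next
    case False
    have "(1 * real m) ^ (2 * r) \<le> (c * real m) ^ (2 * r)"
      using c by (intro power_mono mult_right_mono) auto
    also have "\<dots> \<le> real N"
      using c assms(1,2) by (intro power_le_of_le_floor_powr[OF m_def]) auto
    finally have "real ((m\<^sup>2) ^ r) \<le> real N"
      by (simp add: power_mult)
    then have "int ((m\<^sup>2) ^ r) \<le> int N"
      by linarith
    then have "{0 <.. 0 + int ((m\<^sup>2) ^ card {1..r})} \<subseteq> (\<Union>i\<in>{1..r}. A i)"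
      using assms(3) by auto
    then show ?thesis
      using False by (intro convex_number_ge_of_cover[where a = 0]) auto
  qed
  then have "enat m \<le> (MAX i\<in>{1..r}. convex_number (A i))"
    using assms(1) by (auto simp: Max_ge_iff)
  then show ?thesis
    by (simp add: m_def c_def)
qed

lemma convex_number_dense_difference_set:
  fixes A :: "int set"
  assumes "0 < \<delta>" "s = nat \<lceil>log 2 (1 / (4 * \<delta>))\<rceil>" "N \<ge> 1"
    "A \<subseteq> {1..int N}" "real (card A) \<ge> \<delta> * real N"
  shows "convex_number (difference_set A) \<ge>
    enat (nat \<lfloor>real N powr (1 / (16 * real s + 16)) / (4 * 3 ^ 8)\<rfloor>)"
proof -
  define c :: real where "c = 4 * 3 ^ 8"
  define m where "m = nat \<lfloor>real N powr (1 / real (16 * s + 16)) / c\<rfloor>"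
  have "enat m \<le> convex_number (difference_set A)"
  proof (cases "m = 0")
    case True
    then show ?thesis by (simp flip: zero_enat_def)
  next
    case False
    \<comment> \<open>The density is at least \<open>2 ^ -(s + 2)\<close>, and two increments
      multiply it by 9/4, more than 2; hence \<open>2 * (s + 2)\<close> increments exceed density 1,
      which is \<open>8 ^ (s + 2) < 9 ^ (s + 2)\<close> below.\<close>
    define t where "t = 2 * (s + 2)"
    have "real ((6 * m\<^sup>2) ^ t) \<le> real ((6 * m\<^sup>2) ^ (8 * s + 8))"
      using False by (intro of_nat_mono power_increasing) (auto simp: t_def)
    also have "\<dots> \<le> ((c * real m)\<^sup>2) ^ (8 * s + 8)"
      unfolding of_nat_power by (intro power_mono) (auto simp: c_def power_mult_distrib)
    also have "\<dots> = (c * real m) ^ (16 * s + 16)"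
      by (simp flip: power_mult)
    also have "\<dots> \<le> real N"
      using assms(3) by (intro power_le_of_le_floor_powr[OF m_def]) (auto simp: c_def)
    finally have N: "(6 * m\<^sup>2) ^ t \<le> N"
      by linarith
    \<comment> \<open>For \<open>\<delta>\<close> above 1/4 the logarithm is negative and
      \<open>s\<close> is truncated to 0, so the bound persists.\<close>
    have "log 2 (1 / (4 * \<delta>)) \<le> real s"
      using assms(2) by linarith
    then have "1 / (4 * \<delta>) \<le> 2 powr real s"
      using assms(1) by (subst (asm) log_le_iff) auto
    then have "1 \<le> 2 ^ (s + 2) * \<delta>"
      using assms(1) by (simp add: powr_realpow field_simps)
    then have "1 * real N \<le> 2 ^ (s + 2) * \<delta> * real N"
      by (intro mult_right_mono) auto
    also have "\<dots> \<le> 2 ^ (s + 2) * real (card A)"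
      using assms(5) by simp
    finally have card: "real N \<le> 2 ^ (s + 2) * real (card A)"
      by simp
    then have pos: "0 < card A"
      using assms(3) by (cases "card A = 0") auto
    have "2 ^ t * real N \<le> 4 ^ (s + 2) * (2 ^ (s + 2) * real (card A))"
      using card unfolding t_def power_mult by (intro mult_mono) auto
    also have "\<dots> = 8 ^ (s + 2) * real (card A)"
      by (simp flip: power_mult_distrib mult.assoc)
    also have "\<dots> < 9 ^ (s + 2) * real (card A)"
      using pos by (intro mult_strict_right_mono power_strict_mono) auto
    also have "\<dots> = 3 ^ t * real (card A)"
      by (simp add: t_def power_mult)
    also have "A = A \<inter> {0 <.. 0 + int N}"
      using assms(4) by auto
    finally show ?thesis
      using False N by (intro convex_number_difference_set_ge[of m t N A 0]) auto
  qed
  then show ?thesis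
    by (simp add: m_def c_def)
qed

theorem theorem4:
  "(\<forall>A :: int set.
      case regular_number 2 (real_of_int ` A) of
        enat R \<Rightarrow> convex_number A \<ge> enat (nat \<lfloor>sqrt (real R) / 4\<rfloor>)
      | \<infinity> \<Rightarrow> convex_number A = \<infinity>)
   \<and>
   (\<forall>(r::nat) (N::nat) (A :: nat \<Rightarrow> int set).
      r \<ge> 1 \<longrightarrow> N \<ge> 1 \<longrightarrow>
      disjoint_family_on A {1..r} \<longrightarrow> (\<Union>i\<in>{1..r}. A i) = {1..int N} \<longrightarrow>
      N \<ge> 3 ^ (r\<^sup>2 + r) \<longrightarrow>
      (MAX i\<in>{1..r}. convex_number (A i)) \<ge>
        enat (nat \<lfloor>real N powr (1 / (2 * real r)) / (4 * 3 powr (real r / 2))\<rfloor>))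
   \<and>
   (\<forall>(\<delta>::real) (s::nat) (N::nat) (A :: int set).
      0 < \<delta> \<longrightarrow> \<delta> \<le> 1 \<longrightarrow> s = nat \<lceil>log 2 (1 / (4 * \<delta>))\<rceil> \<longrightarrow>
      N \<ge> 1 \<longrightarrow> N \<ge> max ((2 * s) ^ s) (3 ^ (73 * s)) \<longrightarrow>
      A \<subseteq> {1..int N} \<longrightarrow> real (card A) \<ge> \<delta> * real N \<longrightarrow>
      convex_number (difference_set A) \<ge>
        enat (nat \<lfloor>real N powr (1 / (16 * real s + 16)) / (4 * 3 ^ 8)\<rfloor>))"
  by (intro conjI allI impI convex_number_ge_regular_number convex_number_partition
      convex_number_dense_difference_set) assumption+

end
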